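(* Assume that the mean random dynamical system $\Phi$ on $L^p(\Omega,X)$ possesses an invariant weak $\mathcal{D}$-pullback mean random attractor $\mathcal{A}\in\mathcal{D}$ which is bounded, i.e. $\bigcup_{t\in\mathbb{R}}\mathcal{A}(t)$ is bounded. Then for every $t\in\mathbb{R}$ $$\mathcal{A}(t)=\{\phi(t):\phi\in\mathcal{D}\text{ is a bounded complete trajectory}\}.$$ If, moreover, $\mathcal{D}$ contains any bounded family, then for every $t\in\mathbb{R}$ $$\mathcal{A}(t)=\{\phi(t):\phi\text{ is a bounded complete trajectory}\}.$$
   Context: $X$ is a Banach space, $(\Omega,\mathcal{F},P)$ a probability space, $p\in(1,\infty)$, and $L^p(\Omega,X)$ the Banach space of Bochner integrable $y:\Omega\to X$ with $\int_\Omega\|y\|_X^p\,dP<\infty$. $\mathcal{D}$ is a given collection of families $D=\{D(t)\}_{t\in\mathbb{R}}$ of non-empty bounded sets $D(t)\subset L^p(\Omega,X)$. A mean random dynamical system is a family of maps $\Phi(t,\tau):L^p(\Omega,X)\to L^p(\Omega,X)$, $t\ge0$, $\tau\in\mathbb{R}$, with $\Phi(0,\tau)=\mathrm{id}$ and $\Phi(t+s,\tau)=\Phi(t,s+\tau)\circ\Phi(s,\tau)$ for $t,s\ge0$, $\tau\in\mathbb{R}$. $K\in\mathcal{D}$ is $\mathcal{D}$-pullback weakly attracting if for all $\tau\in\mathbb{R}$, $D\in\mathcal{D}$ and any weak neighborhood $\mathcal{N}^w(K(\tau))$ of $K(\tau)$ there is $T>0$ with $\Phi(t,\tau-t)D(\tau-t)\subset\mathcal{N}^w(K(\tau))$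 for all $t\ge T$. $\mathcal{A}\in\mathcal{D}$ is a weak $\mathcal{D}$-pullback mean random attractor if (1) each $\mathcal{A}(t)$ is weakly compact; (2) $\mathcal{A}$ is $\mathcal{D}$-pullback weakly attracting; (3) if $B\in\mathcal{D}$ satisfies (1) and (2), then $\mathcal{A}(t)\subset B(t)$ for all $t\in\mathbb{R}$. It is invariant if $\mathcal{A}(t)=\Phi(\tau,t-\tau)\mathcal{A}(t-\tau)$ for all $\tau\ge0$, $t\in\mathbb{R}$. A map $\phi:\mathbb{R}\to L^p(\Omega,X)$ is a complete trajectory if $\phi(t)=\Phi(t-s,s)\phi(s)$ for all $s<t$; it is identified with the family of singletons $\{\{\phi(t)\}\}_{t\in\mathbb{R}}$, and $\phi\in\mathcal{D}$ means that this family belongs to $\mathcal{D}$. In this statement a family $D=\{D(t)\}_{t\in\mathbb{R}}$ of non-empty bounded sets is called bounded if $\bigcup_{t\in\mathbb{R}}D(t)$ is bounded.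
   Formalization: The first equality is proved when 𝒟 is inclusion-closed (it contains every family of non-empty subsets of a member); it fails for arbitrary 𝒟, e.g. Φ=id, 𝒜(t)={a,b}, 𝒟={𝒜}; the inclusion ⊇ and the second equality need no such assumption. *)

theory Defs
  imports "HOL-Probability.Probability"
begin

text \<open>
  Bochner integration in the library requires a second countable range space.  Here the range is an
  arbitrary real Banach space, so strong measurability and Bochner integrability are defined as
  usual through approximation by simple functions.  The approximation in strong measurability is
  required at every point instead of almost every point: a strongly measurable function in the
  almost-everywhere sense agrees almost everywhere with one in the pointwise sense, so the
  resulting spaces of equivalence classes are the same, while all functions involved are
  measurable without assuming that the measure is complete.
\<close>

definition strongly_measurable :: "'w measure \<Rightarrow> ('w \<Rightarrow> 'x::banach) \<Rightarrow> bool" where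
  "strongly_measurable M f \<longleftrightarrow>
     (\<exists>s. (\<forall>i::nat. simple_function M (s i)) \<and> (\<forall>x\<in>space M. (\<lambda>i. s i x) \<longlonglongrightarrow> f x))"

definition bochner_integrable :: "'w measure \<Rightarrow> ('w \<Rightarrow> 'x::banach) \<Rightarrow> bool" where
  "bochner_integrable M f \<longleftrightarrow>
     strongly_measurable M f \<and>
     (\<exists>s. (\<forall>i::nat. Bochner_Integration.simple_bochner_integrable M (s i)) \<and>
          (\<lambda>i. \<integral>\<^sup>+x. ennreal (norm (f x - s i x)) \<partial>M) \<longlonglongrightarrow> 0)"

definition Lp_fun :: "'w measure \<Rightarrow> real \<Rightarrow> ('w \<Rightarrow> 'x::banach) set" where
  "Lp_fun M p = {f. bochner_integrable M f \<and> (\<integral>\<^sup>+x. ennreal (norm (f x) powr p) \<partial>M) < \<infinity>}"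

definition ae_rel :: "'w measure \<Rightarrow> real \<Rightarrow> (('w \<Rightarrow> 'x::banach) \<times> ('w \<Rightarrow> 'x)) set" where
  "ae_rel M p = {(f, g). f \<in> Lp_fun M p \<and> g \<in> Lp_fun M p \<and> (AE x in M. f x = g x)}"

definition Lp :: "'w measure \<Rightarrow> real \<Rightarrow> ('w \<Rightarrow> 'x::banach) set set" where
  "Lp M p = Lp_fun M p // ae_rel M p"

definition Lp_class :: "'w measure \<Rightarrow> real \<Rightarrow> ('w \<Rightarrow> 'x::banach) \<Rightarrow> ('w \<Rightarrow> 'x) set" where
  "Lp_class M p f = ae_rel M p `` {f}"

definition Lp_seminorm :: "'w measure \<Rightarrow> real \<Rightarrow> ('w \<Rightarrow> 'x::banach) \<Rightarrow> real" where
  "Lp_seminorm M p f = (\<integral>x. norm (f x) powr p \<partial>M) powr (1 / p)"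

text \<open>All representatives of a class have the same seminorm, so the image below is a singleton.\<close>

definition Lp_norm :: "'w measure \<Rightarrow> real \<Rightarrow> ('w \<Rightarrow> 'x::banach) set \<Rightarrow> real" where
  "Lp_norm M p u = the_elem (Lp_seminorm M p ` u)"

definition Lp_bounded :: "'w measure \<Rightarrow> real \<Rightarrow> ('w \<Rightarrow> 'x::banach) set set \<Rightarrow> bool" where
  "Lp_bounded M p S \<longleftrightarrow> S \<subseteq> Lp M p \<and> (\<exists>C. \<forall>u\<in>S. Lp_norm M p u \<le> C)"

text \<open>
  The topological dual.  The vector space operations of the classes are those induced by the
  pointwise operations on representatives.
\<close>

definition Lp_dual :: "'w measure \<Rightarrow> real \<Rightarrow> (('w \<Rightarrow> 'x::banach) set \<Rightarrow> real) set" where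
  "Lp_dual M p = {l.
     (\<forall>f\<in>Lp_fun M p. \<forall>g\<in>Lp_fun M p.
        l (Lp_class M p (\<lambda>x. f x + g x)) = l (Lp_class M p f) + l (Lp_class M p g)) \<and>
     (\<forall>c. \<forall>f\<in>Lp_fun M p. l (Lp_class M p (\<lambda>x. c *\<^sub>R f x)) = c * l (Lp_class M p f)) \<and>
     (\<exists>C. \<forall>u\<in>Lp M p. \<bar>l u\<bar> \<le> C * Lp_norm M p u)}"

definition weak_topology :: "'w measure \<Rightarrow> real \<Rightarrow> ('w \<Rightarrow> 'x::banach) set topology" where
  "weak_topology M p =
     topology_generated_by {{u \<in> Lp M p. l u \<in> U} | l U. l \<in> Lp_dual M p \<and> open U}"

definition weak_nhd :: "'w measure \<Rightarrow> real \<Rightarrow>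
    ('w \<Rightarrow> 'x::banach) set set \<Rightarrow> ('w \<Rightarrow> 'x) set set \<Rightarrow> bool" where
  "weak_nhd M p K N \<longleftrightarrow>
     N \<subseteq> Lp M p \<and> (\<exists>U. openin (weak_topology M p) U \<and> K \<subseteq> U \<and> U \<subseteq> N)"

type_synonym ('w, 'x) Lp_family = "real \<Rightarrow> ('w \<Rightarrow> 'x) set set"

definition Lp_families :: "'w measure \<Rightarrow> real \<Rightarrow> ('w, 'x::banach) Lp_family set" where
  "Lp_families M p = {D. \<forall>t. D t \<noteq> {} \<and> Lp_bounded M p (D t)}"

definition bounded_family :: "'w measure \<Rightarrow> real \<Rightarrow> ('w, 'x::banach) Lp_family \<Rightarrow> bool" where
  "bounded_family M p D \<longleftrightarrow> Lp_bounded M p (\<Union>t. D t)"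

definition inclusion_closed :: "('w, 'x::banach) Lp_family set \<Rightarrow> bool" where
  "inclusion_closed \<D> \<longleftrightarrow>
     (\<forall>D\<in>\<D>. \<forall>D'. (\<forall>t. D' t \<noteq> {} \<and> D' t \<subseteq> D t) \<longrightarrow> D' \<in> \<D>)"

type_synonym ('w, 'x) Lp_flow = "real \<Rightarrow> real \<Rightarrow> ('w \<Rightarrow> 'x) set \<Rightarrow> ('w \<Rightarrow> 'x) set"

definition mean_rds :: "'w measure \<Rightarrow> real \<Rightarrow> ('w, 'x::banach) Lp_flow \<Rightarrow> bool" where
  "mean_rds M p \<Phi> \<longleftrightarrow>
     (\<forall>t\<ge>0. \<forall>\<tau>. \<forall>u\<in>Lp M p. \<Phi> t \<tau> u \<in> Lp M p) \<and>
     (\<forall>\<tau>. \<forall>u\<in>Lp M p. \<Phi> 0 \<tau> u = u) \<and>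
     (\<forall>t\<ge>0. \<forall>s\<ge>0. \<forall>\<tau>. \<forall>u\<in>Lp M p. \<Phi> (t + s) \<tau> u = \<Phi> t (s + \<tau>) (\<Phi> s \<tau> u))"

definition pullback_weakly_attracting :: "'w measure \<Rightarrow> real \<Rightarrow>
    ('w, 'x::banach) Lp_family set \<Rightarrow> ('w, 'x) Lp_flow \<Rightarrow> ('w, 'x) Lp_family \<Rightarrow> bool" where
  "pullback_weakly_attracting M p \<D> \<Phi> K \<longleftrightarrow>
     K \<in> \<D> \<and>
     (\<forall>\<tau>. \<forall>D\<in>\<D>. \<forall>N. weak_nhd M p (K \<tau>) N \<longrightarrow>
        (\<exists>T>0. \<forall>t\<ge>T. \<Phi> t (\<tau> - t) ` D (\<tau> - t) \<subseteq> N))"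

definition weak_pullback_attractor :: "'w measure \<Rightarrow> real \<Rightarrow>
    ('w, 'x::banach) Lp_family set \<Rightarrow> ('w, 'x) Lp_flow \<Rightarrow> ('w, 'x) Lp_family \<Rightarrow> bool" where
  "weak_pullback_attractor M p \<D> \<Phi> A \<longleftrightarrow>
     A \<in> \<D> \<and>
     (\<forall>t. compactin (weak_topology M p) (A t)) \<and>
     pullback_weakly_attracting M p \<D> \<Phi> A \<and>
     (\<forall>B\<in>\<D>. (\<forall>t. compactin (weak_topology M p) (B t)) \<and>
              pullback_weakly_attracting M p \<D> \<Phi> B \<longrightarrow> (\<forall>t. A t \<subseteq> B t))"

definition invariant_family ::
    "('w, 'x::banach) Lp_flow \<Rightarrow> ('w, 'x) Lp_family \<Rightarrow> bool" where
  "invariant_family \<Phi> A \<longleftrightarrow> (\<forall>\<tau>\<ge>0. \<forall>t. A t = \<Phi> \<tau> (t - \<tau>) ` A (t - \<tau>))"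

definition complete_trajectory :: "'w measure \<Rightarrow> real \<Rightarrow>
    ('w, 'x::banach) Lp_flow \<Rightarrow> (real \<Rightarrow> ('w \<Rightarrow> 'x) set) \<Rightarrow> bool" where
  "complete_trajectory M p \<Phi> \<phi> \<longleftrightarrow>
     (\<forall>t. \<phi> t \<in> Lp M p) \<and> (\<forall>s t. s < t \<longrightarrow> \<phi> t = \<Phi> (t - s) s (\<phi> s))"

definition singleton_family :: "(real \<Rightarrow> ('w \<Rightarrow> 'x::banach) set) \<Rightarrow> ('w, 'x) Lp_family" where
  "singleton_family \<phi> = (\<lambda>t. {\<phi> t})"

definition bounded_complete_trajectory :: "'w measure \<Rightarrow> real \<Rightarrow>
    ('w, 'x::banach) Lp_flow \<Rightarrow> (real \<Rightarrow> ('w \<Rightarrow> 'x) set) \<Rightarrow> bool" where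
  "bounded_complete_trajectory M p \<Phi> \<phi> \<longleftrightarrow>
     complete_trajectory M p \<Phi> \<phi> \<and> bounded_family M p (singleton_family \<phi>)"

end

theory Submission
  imports Defs
begin

text \<open>
  A trajectory in \<open>\<D>\<close> is a pullback image of itself, so it lies in every weak neighborhood of the
  attractor; since the weak topology separates points, it lies in the attractor.  Functionals that
  separate two classes have the form \<open>f \<mapsto> \<integral>\<^sub>E k(f) dP\<close> with \<open>k\<close> in the dual of the range space.
  Conversely, invariance yields preimages of a point of the attractor at the times
  \<open>t - 1, t - 2, \<dots>\<close>, and flowing forward from them gives a complete trajectory inside the attractor.
\<close>

section \<open>Hahn--Banach\<close>

text \<open>A dominated functional on a subspace is encoded by its graph, a subspace
  \<open>G\<close> of the product with the reals, so that extending it means enlarging a set.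
  Subadditivity gives \<open>cross\<close>: every lower bound on the value at \<open>y\<close> lies
  below every upper bound, and the supremum \<open>r0\<close> of the lower bounds is
  admissible.\<close>

lemma hahn_banach_graph_extend:
  fixes q :: "'a::real_vector \<Rightarrow> real"
  assumes q_add: "\<And>x y. q (x + y) \<le> q x + q y"
    and q_scale: "\<And>c x. 0 \<le> c \<Longrightarrow> q (c *\<^sub>R x) = c * q x"
    and G: "subspace G" "\<And>x r. (x, r) \<in> G \<Longrightarrow> r \<le> q x"
  obtains r0 where "\<And>x r. (x, r) \<in> span (insert (y, r0) G) \<Longrightarrow> r \<le> q x"
proof -
  define L where "L = {r' - q (x' - y) | x' r'. (x', r') \<in> G}"
  have cross: "r' - q (x' - y) \<le> q (x + y) - r" if "(x, r) \<in> G" "(x', r') \<in> G" for x r x' r'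
  proof -
    have "(x + x', r + r') \<in> G"
      using subspace_add[OF G(1) that] by simp
    then have "r + r' \<le> q (x + x')" by (rule G(2))
    also have "\<dots> \<le> q (x + y) + q (x' - y)"
      using q_add[of "x + y" "x' - y"] by simp
    finally show ?thesis by simp
  qed
  \<comment> \<open>The zero pair makes \<open>L\<close> nonempty and, through \<open>cross\<close>,
    bounded above, as \<open>Sup L\<close> requires.\<close>
  have zero: "(0, 0) \<in> G"
    using subspace_0[OF G(1)] by (simp add: zero_prod_def)
  then have Lne: "L \<noteq> {}" by (auto simp: L_def)
  have Lbdd: "bdd_above L"
    using cross[OF zero] by (auto simp: L_def bdd_above_def)
  define r0 where "r0 = Sup L"
  have lower: "r' - r0 \<le> q (x' - y)" if "(x', r') \<in> G" for x' r'
  proof -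
    have "r' - q (x' - y) \<le> r0"
      unfolding r0_def using that Lbdd by (intro cSup_upper) (auto simp: L_def)
    then show ?thesis by simp
  qed
  have upper: "r + r0 \<le> q (x + y)" if "(x, r) \<in> G" for x r
  proof -
    have "r0 \<le> q (x + y) - r"
      unfolding r0_def using Lne cross[OF that] by (intro cSup_least) (auto simp: L_def)
    then show ?thesis by simp
  qed
  \<comment> \<open>Homogeneity reduces a general coefficient to \<plusminus>1: dividing by
    \<open>\<bar>c\<bar>\<close> leaves \<open>upper\<close> for positive \<open>c\<close> and
    \<open>lower\<close> for negative \<open>c\<close>.\<close>
  have bound: "r + c * r0 \<le> q (x + c *\<^sub>R y)" if xr: "(x, r) \<in> G" for x r c
  proof (cases "c = 0")
    case True
    then show ?thesis using G(2)[OF xr] by simp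
  next
    case False
    define d where "d = \<bar>c\<bar>"
    have d: "d > 0" using False by (simp add: d_def)
    have sc: "(x /\<^sub>R d, r / d) \<in> G"
      using subspace_scale[OF G(1) xr, of "inverse d"] by (simp add: divide_inverse mult.commute)
    show ?thesis
    proof (cases "c > 0")
      case True
      then have dc: "d = c" by (simp add: d_def)
      have "d * (r / d + r0) \<le> d * q (x /\<^sub>R d + y)"
        using upper[OF sc] d by (intro mult_left_mono) auto
      also have "\<dots> = q (d *\<^sub>R (x /\<^sub>R d + y))"
        using d by (simp add: q_scale)
      finally show ?thesis using d by (simp add: dc distrib_left scaleR_add_right)
    next
      case False
      then have dc: "c = - d" by (simp add: d_def)
      have "d * (r / d - r0) \<le> d * q (x /\<^sub>R d - y)"
        using lower[OF sc] d by (intro mult_left_mono) auto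
      also have "\<dots> = q (d *\<^sub>R (x /\<^sub>R d - y))"
        using d by (simp add: q_scale)
      finally show ?thesis using d by (simp add: dc right_diff_distrib scaleR_diff_right)
    qed
  qed
  show ?thesis
  proof (rule that)
    fix x r
    assume "(x, r) \<in> span (insert (y, r0) G)"
    then obtain c where "(x, r) - c *\<^sub>R (y, r0) \<in> span G"
      by (auto simp: span_insert)
    then have "(x - c *\<^sub>R y, r - c * r0) \<in> G"
      using G(1) by (simp add: span_eq_iff[THEN iffD2])
    from bound[OF this, of c] show "r \<le> q x" by simp
  qed
qed

text \<open>Zorn's lemma on the dominated graphs through \<open>(x0, q x0)\<close>, starting from
  the line spanned by this pair; the prescribed pair makes the bound tight at \<open>x0\<close>. A
  maximal graph is defined everywhere by one-dimensional extension.\<close>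

theorem hahn_banach_sublinear:
  fixes q :: "'a::real_vector \<Rightarrow> real"
  assumes q_add: "\<And>x y. q (x + y) \<le> q x + q y"
    and q_scale: "\<And>c x. 0 \<le> c \<Longrightarrow> q (c *\<^sub>R x) = c * q x"
  obtains k where "linear k" "\<And>x. k x \<le> q x" "k x0 = q x0"
proof -
  define \<G> where "\<G> = {G. subspace G \<and> (x0, q x0) \<in> G \<and> (\<forall>(x, r)\<in>G. r \<le> q x)}"
  have q0: "q 0 = 0" using q_scale[of 0 0] by simp
  have "span {(x0, q x0)} \<in> \<G>"
  proof -
    have "c * q x0 \<le> q (c *\<^sub>R x0)" for c
    proof (cases "c \<ge> 0")
      case True
      then show ?thesis by (simp add: q_scale)
    next
      case False
      have "0 \<le> q (c *\<^sub>R x0) + q ((- c) *\<^sub>R x0)"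
        using q_add[of "c *\<^sub>R x0" "(- c) *\<^sub>R x0"] q0 by simp
      moreover have "q ((- c) *\<^sub>R x0) = - c * q x0"
        using False by (intro q_scale) auto
      ultimately show ?thesis by simp
    qed
    then have "\<forall>(x, r)\<in>span {(x0, q x0)}. r \<le> q x"
      by (auto simp: span_singleton)
    then show ?thesis
      by (simp add: \<G>_def subspace_span span_base)
  qed
  then have "\<G> \<noteq> {}" by auto
  moreover have "\<Union>C \<in> \<G>" if C: "C \<noteq> {}" "subset.chain \<G> C" for C
  proof -
    have CG: "G \<in> \<G>" if "G \<in> C" for G
      using C(2) that by (auto simp: subset.chain_def)
    have tot: "G \<subseteq> H \<or> H \<subseteq> G" if "G \<in> C" "H \<in> C" for G H
      using C(2) that by (auto simp: subset_chain_def)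
    have "subspace (\<Union>C)"
    proof (rule subspaceI)
      show "0 \<in> \<Union>C" using C(1) CG subspace_0 by (fastforce simp: \<G>_def)
    next
      fix u v assume "u \<in> \<Union>C" "v \<in> \<Union>C"
      then obtain G H where GH: "G \<in> C" "u \<in> G" "H \<in> C" "v \<in> H" by auto
      define K where "K = (if G \<subseteq> H then H else G)"
      have "K \<in> C" "u \<in> K" "v \<in> K" using GH tot[of G H] by (auto simp: K_def)
      moreover have "u + v \<in> K"
        using CG[OF \<open>K \<in> C\<close>] calculation by (auto simp: \<G>_def intro: subspace_add)
      ultimately show "u + v \<in> \<Union>C" by auto
    next
      fix c u assume "u \<in> \<Union>C"
      then show "c *\<^sub>R u \<in> \<Union>C" using CG by (auto simp: \<G>_def intro: subspace_scale)
    qed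
    then show ?thesis using C(1) CG by (fastforce simp: \<G>_def)
  qed
  ultimately obtain G where G: "G \<in> \<G>" and max: "\<And>H. H \<in> \<G> \<Longrightarrow> G \<subseteq> H \<Longrightarrow> H = G"
    using subset_Zorn_nonempty[of \<G>] by auto
  have sub: "subspace G" and x0: "(x0, q x0) \<in> G" and dom: "\<And>x r. (x, r) \<in> G \<Longrightarrow> r \<le> q x"
    using G by (auto simp: \<G>_def)
  \<comment> \<open>Two values over the same point differ by a value over 0, and domination by
    \<open>q 0 = 0\<close> in both signs forces it to vanish. So elements of \<open>\<G>\<close> are
    graphs of functions although this is not part of their definition.\<close>
  have uniq: "r = r'" if "(x, r) \<in> G" "(x, r') \<in> G" for x r r'
    using dom[of 0 "r - r'"] dom[of 0 "r' - r"] subspace_diff[OF sub that]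
      subspace_diff[OF sub that(2,1)] q0 by simp
  have ex: "\<exists>r. (y, r) \<in> G" for y
  proof -
    obtain r0 where r0: "\<And>x r. (x, r) \<in> span (insert (y, r0) G) \<Longrightarrow> r \<le> q x"
      using hahn_banach_graph_extend[OF q_add q_scale sub dom] by blast
    let ?H = "span (insert (y, r0) G)"
    \<comment> \<open>The extension again belongs to \<open>\<G>\<close>, so maximality makes it
      equal to \<open>G\<close>, which therefore already has a value at \<open>y\<close>.\<close>
    have "insert (y, r0) G \<subseteq> ?H" by (rule span_superset)
    moreover from this have "?H \<in> \<G>" using x0 r0 by (auto simp: \<G>_def)
    ultimately show ?thesis using max[of ?H] by auto
  qed
  define k where "k x = (THE r. (x, r) \<in> G)" for x
  have k: "(x, r) \<in> G \<longleftrightarrow> k x = r" for x r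
  proof -
    obtain r0 where r0: "(x, r0) \<in> G" using ex by blast
    then have "k x = r0" unfolding k_def by (rule the_equality) (rule uniq[OF _ r0])
    then show ?thesis using r0 uniq by blast
  qed
  have kin: "(x, k x) \<in> G" for x using k by blast
  show ?thesis
  proof (rule that)
    show "linear k"
    proof (rule linearI)
      fix x y show "k (x + y) = k x + k y"
        using subspace_add[OF sub kin[of x] kin[of y]] by (simp add: k)
    next
      fix c x show "k (c *\<^sub>R x) = c *\<^sub>R k x"
        using subspace_scale[OF sub kin[of x], of c] by (simp add: k)
    qed
    show "k x \<le> q x" for x by (rule dom[OF kin])
    show "k x0 = q x0" using x0 by (simp add: k)
  qed
qed

corollary norming_functional:
  fixes x0 :: "'a::real_normed_vector"
  obtains k :: "'a \<Rightarrow> real" where "linear k" "\<And>x. \<bar>k x\<bar> \<le> norm x" "k x0 = norm x0"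
proof -
  obtain k :: "'a \<Rightarrow> real" where k: "linear k" "\<And>x. k x \<le> norm x" "k x0 = norm x0"
    using hahn_banach_sublinear[of norm x0] by (auto intro: norm_triangle_ineq)
  have "\<bar>k x\<bar> \<le> norm x" for x
    using k(2)[of x] k(2)[of "- x"] linear_neg[OF k(1), of x] by simp
  with k that show ?thesis by blast
qed

section \<open>Strong measurability and the Lebesgue--Bochner space\<close>

lemma strongly_measurableE:
  assumes "strongly_measurable M f"
  obtains s where "\<And>i::nat. simple_function M (s i)"
    "\<And>x. x \<in> space M \<Longrightarrow> (\<lambda>i. s i x) \<longlonglongrightarrow> f x"
  using assms unfolding strongly_measurable_def by blast

lemma bochner_integrableE:
  assumes "bochner_integrable M f"
  obtains s where "\<And>i::nat. Bochner_Integration.simple_bochner_integrable M (s i)"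
    "(\<lambda>i. \<integral>\<^sup>+x. ennreal (norm (f x - s i x)) \<partial>M) \<longlonglongrightarrow> 0"
  using assms unfolding bochner_integrable_def by blast

lemma strongly_measurable_simple: "simple_function M s \<Longrightarrow> strongly_measurable M s"
  unfolding strongly_measurable_def by (intro exI[of _ "\<lambda>_. s"]) auto

lemma strongly_measurable_add:
  assumes "strongly_measurable M f" "strongly_measurable M g"
  shows "strongly_measurable M (\<lambda>x. f x + g x)"
proof -
  obtain s where s: "\<And>i::nat. simple_function M (s i)" "\<And>x. x \<in> space M \<Longrightarrow> (\<lambda>i. s i x) \<longlonglongrightarrow> f x"
    using assms(1) by (rule strongly_measurableE) blast
  obtain t where t: "\<And>i::nat. simple_function M (t i)" "\<And>x. x \<in> space M \<Longrightarrow> (\<lambda>i. t i x) \<longlonglongrightarrow> g x"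
    using assms(2) by (rule strongly_measurableE) blast
  show ?thesis
    unfolding strongly_measurable_def
    by (intro exI[of _ "\<lambda>i x. s i x + t i x"] conjI allI ballI tendsto_add s(2) t(2)
        simple_function_compose2[OF s(1) t(1), of "(+)"])
qed

lemma strongly_measurable_scaleR:
  assumes "strongly_measurable M f"
  shows "strongly_measurable M (\<lambda>x. c *\<^sub>R f x)"
proof -
  obtain s where s: "\<And>i::nat. simple_function M (s i)" "\<And>x. x \<in> space M \<Longrightarrow> (\<lambda>i. s i x) \<longlonglongrightarrow> f x"
    using assms by (rule strongly_measurableE) blast
  show ?thesis
    unfolding strongly_measurable_def
    by (intro exI[of _ "\<lambda>i x. c *\<^sub>R s i x"] conjI allI ballI tendsto_scaleR tendsto_const s(2)
        simple_function_compose1[OF s(1), of "\<lambda>y. c *\<^sub>R y"])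
qed

lemma strongly_measurable_diff:
  assumes "strongly_measurable M f" "strongly_measurable M g"
  shows "strongly_measurable M (\<lambda>x. f x - g x)"
  using strongly_measurable_add[OF assms(1) strongly_measurable_scaleR[OF assms(2), of "-1"]] by simp

text \<open>Composing with \<open>k\<close> turns the approximating simple functions into real ones,
  whose pointwise limit is measurable; the possibly nonseparable range is left behind.\<close>

lemma borel_measurable_continuous_strongly_measurable:
  fixes k :: "'x::banach \<Rightarrow> real"
  assumes f: "strongly_measurable M f" and k: "continuous_on UNIV k"
  shows "(\<lambda>x. k (f x)) \<in> borel_measurable M"
proof -
  obtain s where s: "\<And>i::nat. simple_function M (s i)" "\<And>x. x \<in> space M \<Longrightarrow> (\<lambda>i. s i x) \<longlonglongrightarrow> f x"
    using f by (rule strongly_measurableE) blast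
  show ?thesis
  proof (rule borel_measurable_LIMSEQ_real)
    show "(\<lambda>i. k (s i x)) \<longlonglongrightarrow> k (f x)" if "x \<in> space M" for x
      using k s(2)[OF that] by (rule continuous_on_tendsto_compose) auto
    show "(\<lambda>x. k (s i x)) \<in> borel_measurable M" for i
      by (rule borel_measurable_simple_function) (rule simple_function_compose1[OF s(1), of k])
  qed
qed

lemma borel_measurable_norm_strongly_measurable:
  "strongly_measurable M f \<Longrightarrow> (\<lambda>x. norm (f x)) \<in> borel_measurable M"
  by (rule borel_measurable_continuous_strongly_measurable) (auto intro: continuous_intros)

lemma simple_bochner_integrable_imp_simple:
  "Bochner_Integration.simple_bochner_integrable M s \<Longrightarrow> simple_function M s"
  by (simp add: Bochner_Integration.simple_bochner_integrable.simps)

section \<open>Vector operations on Bochner integrable functions\<close>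

lemma bochner_integrable_add:
  assumes "bochner_integrable M f" "bochner_integrable M g"
  shows "bochner_integrable M (\<lambda>x. f x + g x)"
proof -
  obtain s where s: "\<And>i::nat. Bochner_Integration.simple_bochner_integrable M (s i)"
      "(\<lambda>i. \<integral>\<^sup>+x. ennreal (norm (f x - s i x)) \<partial>M) \<longlonglongrightarrow> 0"
    using assms(1) by (rule bochner_integrableE) blast
  obtain t where t: "\<And>i::nat. Bochner_Integration.simple_bochner_integrable M (t i)"
      "(\<lambda>i. \<integral>\<^sup>+x. ennreal (norm (g x - t i x)) \<partial>M) \<longlonglongrightarrow> 0"
    using assms(2) by (rule bochner_integrableE) blast
  have f: "strongly_measurable M f" and g: "strongly_measurable M g"
    using assms by (auto simp: bochner_integrable_def)
  have meas: "(\<lambda>x. norm (f x - s i x)) \<in> borel_measurable M"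
    "(\<lambda>x. norm (g x - t i x)) \<in> borel_measurable M" for i
    by (intro borel_measurable_norm_strongly_measurable strongly_measurable_diff f g
        strongly_measurable_simple[OF simple_bochner_integrable_imp_simple] s(1) t(1))+
  have le: "(\<integral>\<^sup>+x. ennreal (norm (f x + g x - (s i x + t i x))) \<partial>M)
      \<le> (\<integral>\<^sup>+x. ennreal (norm (f x - s i x)) \<partial>M) + (\<integral>\<^sup>+x. ennreal (norm (g x - t i x)) \<partial>M)" for i
  proof -
    have "(\<integral>\<^sup>+x. ennreal (norm (f x + g x - (s i x + t i x))) \<partial>M)
        \<le> (\<integral>\<^sup>+x. ennreal (norm (f x - s i x)) + ennreal (norm (g x - t i x)) \<partial>M)"
      by (intro nn_integral_mono)
        (simp add: ennreal_plus[symmetric] norm_diff_triangle_ineq del: ennreal_plus)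
    also have "\<dots> = (\<integral>\<^sup>+x. ennreal (norm (f x - s i x)) \<partial>M)
        + (\<integral>\<^sup>+x. ennreal (norm (g x - t i x)) \<partial>M)"
      using meas by (intro nn_integral_add) auto
    finally show ?thesis .
  qed
  have "(\<lambda>i. \<integral>\<^sup>+x. ennreal (norm (f x + g x - (s i x + t i x))) \<partial>M) \<longlonglongrightarrow> 0"
  proof (rule tendsto_sandwich[OF _ _ tendsto_const])
    show "(\<lambda>i. (\<integral>\<^sup>+x. ennreal (norm (f x - s i x)) \<partial>M)
        + (\<integral>\<^sup>+x. ennreal (norm (g x - t i x)) \<partial>M)) \<longlonglongrightarrow> 0"
      using tendsto_add[OF s(2) t(2)] by simp
  qed (use le in auto)
  moreover have "Bochner_Integration.simple_bochner_integrable M (\<lambda>x. s i x + t i x)" for i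
    by (rule simple_bochner_integrable_compose2[of "(+)", OF _ s(1) t(1)]) simp
  ultimately show ?thesis
    using strongly_measurable_add[OF f g] unfolding bochner_integrable_def
    by (intro conjI exI[of _ "\<lambda>i x. s i x + t i x"]) auto
qed

lemma bochner_integrable_scaleR:
  assumes "bochner_integrable M f"
  shows "bochner_integrable M (\<lambda>x. c *\<^sub>R f x)"
proof -
  obtain s where s: "\<And>i::nat. Bochner_Integration.simple_bochner_integrable M (s i)"
      "(\<lambda>i. \<integral>\<^sup>+x. ennreal (norm (f x - s i x)) \<partial>M) \<longlonglongrightarrow> 0"
    using assms by (rule bochner_integrableE) blast
  have f: "strongly_measurable M f"
    using assms by (auto simp: bochner_integrable_def)
  have meas: "(\<lambda>x. norm (f x - s i x)) \<in> borel_measurable M" for i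
    by (intro borel_measurable_norm_strongly_measurable strongly_measurable_diff f
        strongly_measurable_simple[OF simple_bochner_integrable_imp_simple] s(1))
  have eq: "(\<integral>\<^sup>+x. ennreal (norm (c *\<^sub>R f x - c *\<^sub>R s i x)) \<partial>M)
      = ennreal \<bar>c\<bar> * (\<integral>\<^sup>+x. ennreal (norm (f x - s i x)) \<partial>M)" for i
    using meas
    by (simp add: scaleR_diff_right[symmetric] ennreal_mult nn_integral_cmult)
  have "(\<lambda>i. \<integral>\<^sup>+x. ennreal (norm (c *\<^sub>R f x - c *\<^sub>R s i x)) \<partial>M) \<longlonglongrightarrow> 0"
    unfolding eq using ennreal_tendsto_cmult[OF _ s(2), of "ennreal \<bar>c\<bar>"] by simp
  moreover have "Bochner_Integration.simple_bochner_integrable M (\<lambda>x. c *\<^sub>R s i x)" for i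
    by (rule simple_bochner_integrable_compose2[of "\<lambda>a _. c *\<^sub>R a", OF _ s(1) s(1)]) simp
  ultimately show ?thesis
    using strongly_measurable_scaleR[OF f] unfolding bochner_integrable_def
    by (intro conjI exI[of _ "\<lambda>i x. c *\<^sub>R s i x"]) auto
qed

section \<open>The functions with integrable \<open>p\<close>-th power of the norm\<close>

lemma Lp_fun_strongly_measurable: "f \<in> Lp_fun M p \<Longrightarrow> strongly_measurable M f"
  by (simp add: Lp_fun_def bochner_integrable_def)

lemma Lp_fun_measurable_norm [measurable]:
  "f \<in> Lp_fun M p \<Longrightarrow> (\<lambda>x. norm (f x)) \<in> borel_measurable M"
  by (intro borel_measurable_norm_strongly_measurable Lp_fun_strongly_measurable)

lemma Lp_fun_integrable_powr:
  assumes "f \<in> Lp_fun M p"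
  shows "integrable M (\<lambda>x. norm (f x) powr p)"
  using assms Lp_fun_measurable_norm[OF assms]
  by (intro integrableI_nonneg) (auto simp: Lp_fun_def)

lemma Lp_funI:
  assumes "bochner_integrable M f" "integrable M (\<lambda>x. norm (f x) powr p)"
  shows "f \<in> Lp_fun M p"
  using assms by (auto simp: Lp_fun_def integrable_iff_bounded)

lemma powr_add_le:
  fixes a b p :: real
  assumes "0 \<le> a" "0 \<le> b" "0 \<le> p"
  shows "(a + b) powr p \<le> 2 powr p * (a powr p + b powr p)"
proof -
  \<comment> \<open>Bounding the sum by twice the maximum replaces a convexity argument; the crude
    constant suffices for closure under sums.\<close>
  have "(a + b) powr p \<le> (2 * max a b) powr p"
    using assms by (intro powr_mono2) auto
  also have "\<dots> = 2 powr p * max a b powr p"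
    using assms by (simp add: powr_mult)
  also have "\<dots> \<le> 2 powr p * (a powr p + b powr p)"
    by (intro mult_left_mono) (auto simp: max_def)
  finally show ?thesis .
qed

lemma Lp_fun_add:
  assumes f: "f \<in> Lp_fun M p" and g: "g \<in> Lp_fun M p" and p: "0 \<le> p"
  shows "(\<lambda>x. f x + g x) \<in> Lp_fun M p"
proof (rule Lp_funI)
  show B: "bochner_integrable M (\<lambda>x. f x + g x)"
    using f g by (intro bochner_integrable_add) (auto simp: Lp_fun_def)
  then have [measurable]: "(\<lambda>x. norm (f x + g x)) \<in> borel_measurable M"
    by (intro borel_measurable_norm_strongly_measurable) (simp add: bochner_integrable_def)
  have le: "norm (f x + g x) powr p \<le> 2 powr p * (norm (f x) powr p + norm (g x) powr p)" for x
  proof -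
    have "norm (f x + g x) powr p \<le> (norm (f x) + norm (g x)) powr p"
      using p by (intro powr_mono2) (auto intro: norm_triangle_ineq)
    also have "\<dots> \<le> 2 powr p * (norm (f x) powr p + norm (g x) powr p)"
      using p by (intro powr_add_le) auto
    finally show ?thesis .
  qed
  show "integrable M (\<lambda>x. norm (f x + g x) powr p)"
  proof (rule Bochner_Integration.integrable_bound)
    show "integrable M (\<lambda>x. 2 powr p * (norm (f x) powr p + norm (g x) powr p))"
      by (intro integrable_mult_right Bochner_Integration.integrable_add Lp_fun_integrable_powr f g)
    show "AE x in M. norm (norm (f x + g x) powr p)
        \<le> norm (2 powr p * (norm (f x) powr p + norm (g x) powr p))"
      using le by (intro AE_I2) simp
  qed measurable
qed

lemma Lp_fun_scaleR:
  assumes f: "f \<in> Lp_fun M p"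
  shows "(\<lambda>x. c *\<^sub>R f x) \<in> Lp_fun M p"
proof (rule Lp_funI)
  show "bochner_integrable M (\<lambda>x. c *\<^sub>R f x)"
    using f by (intro bochner_integrable_scaleR) (auto simp: Lp_fun_def)
  show "integrable M (\<lambda>x. norm (c *\<^sub>R f x) powr p)"
    using Lp_fun_integrable_powr[OF f] by (simp add: powr_mult)
qed

section \<open>Classes modulo almost everywhere equality and their norm\<close>

lemma equiv_ae_rel: "equiv (Lp_fun M p) (ae_rel M p)"
proof (rule equivI)
  show "ae_rel M p \<subseteq> Lp_fun M p \<times> Lp_fun M p" by (auto simp: ae_rel_def)
  show "refl_on (Lp_fun M p) (ae_rel M p)" by (auto simp: refl_on_def ae_rel_def)
  show "sym (ae_rel M p)" by (auto simp: sym_def ae_rel_def eq_commute)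
  show "trans (ae_rel M p)"
  proof (rule transI)
    fix f g h assume "(f, g) \<in> ae_rel M p" "(g, h) \<in> ae_rel M p"
    then have fh: "f \<in> Lp_fun M p" "h \<in> Lp_fun M p"
      and "AE x in M. f x = g x" "AE x in M. g x = h x" by (auto simp: ae_rel_def)
    from this(3,4) have "AE x in M. f x = h x" by eventually_elim simp
    with fh show "(f, h) \<in> ae_rel M p" by (simp add: ae_rel_def)
  qed
qed

lemma Lp_cases:
  assumes "u \<in> Lp M p"
  obtains f where "f \<in> Lp_fun M p" "u = Lp_class M p f"
  using assms by (auto simp: Lp_def Lp_class_def elim: quotientE)

lemma mem_Lp_class: "g \<in> Lp_class M p f \<longleftrightarrow> f \<in> Lp_fun M p \<and> g \<in> Lp_fun M p \<and> (AE x in M. f x = g x)"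
  by (auto simp: Lp_class_def ae_rel_def)

lemma Lp_class_self: "f \<in> Lp_fun M p \<Longrightarrow> f \<in> Lp_class M p f"
  by (simp add: mem_Lp_class)

lemma Lp_class_eqI:
  assumes "f \<in> Lp_fun M p" "g \<in> Lp_fun M p" "AE x in M. f x = g x"
  shows "Lp_class M p f = Lp_class M p g"
  unfolding Lp_class_def using assms equiv_class_eq[OF equiv_ae_rel]
  by (auto simp: ae_rel_def)

lemma Lp_norm_class:
  assumes f: "f \<in> Lp_fun M p"
  shows "Lp_norm M p (Lp_class M p f) = Lp_seminorm M p f"
proof -
  have "Lp_seminorm M p g = Lp_seminorm M p f" if "g \<in> Lp_class M p f" for g
  proof -
    have g: "g \<in> Lp_fun M p" and ae: "AE x in M. f x = g x" using that by (auto simp: mem_Lp_class)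
    have "(\<integral>x. norm (g x) powr p \<partial>M) = (\<integral>x. norm (f x) powr p \<partial>M)"
    proof (rule integral_cong_AE)
      show "AE x in M. norm (g x) powr p = norm (f x) powr p"
        using ae by eventually_elim simp
    qed (intro borel_measurable_integrable Lp_fun_integrable_powr f g)+
    then show ?thesis unfolding Lp_seminorm_def by (rule arg_cong)
  qed
  then have "Lp_seminorm M p ` Lp_class M p f = {Lp_seminorm M p f}"
    using Lp_class_self[OF f] by blast
  then show ?thesis by (simp add: Lp_norm_def)
qed

section \<open>Comparison of the L^1 and L^p norms\<close>

lemma le_add_powr:
  fixes a c p :: real
  assumes "0 \<le> a" "0 < c" "1 \<le> p"
  shows "a \<le> c + c powr (1 - p) * a powr p"
proof (cases "a \<le> c")
  case True
  then show ?thesis by (simp add: add_increasing2)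
next
  case False
  then have a: "0 < a" "c \<le> a" using assms by auto
  \<comment> \<open>The two powers of \<open>c\<close> cancel. As \<open>c \<le> a\<close> and
    \<open>p \<ge> 1\<close>, replacing \<open>c powr (p - 1)\<close> by
    \<open>a powr (p - 1)\<close> only increases the product and gives the second summand of the
    bound.\<close>
  have "a = c powr (1 - p) * c powr (p - 1) * a"
    using assms by (simp add: powr_add[symmetric])
  also have "\<dots> \<le> c powr (1 - p) * a powr (p - 1) * a"
    using a assms by (intro mult_right_mono mult_left_mono powr_mono2) auto
  also have "\<dots> = c powr (1 - p) * a powr p"
    using a by (simp add: powr_diff)
  finally show ?thesis using assms by simp
qed

lemma (in prob_space) Lp_fun_integrable_norm:
  assumes f: "f \<in> Lp_fun M p" and p: "1 \<le> p"
  shows "integrable M (\<lambda>x. norm (f x))"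
proof (rule Bochner_Integration.integrable_bound)
  \<comment> \<open>The pointwise bound with \<open>c = 1\<close>; the constant is integrable
    because the total mass is 1.\<close>
  show "integrable M (\<lambda>x. 1 + norm (f x) powr p)"
    using Lp_fun_integrable_powr[OF f] by auto
  show "AE x in M. norm (norm (f x)) \<le> norm (1 + norm (f x) powr p)"
    using le_add_powr[of _ 1 p] p by auto
qed (use f in measurable)

text \<open>
  Integrating the pointwise bound above with \<open>c\<close> the \<open>p\<close>-norm avoids Hoelder's inequality at the
  cost of a factor 2.
\<close>

lemma (in prob_space) integral_norm_le_Lp_seminorm:
  assumes f: "f \<in> Lp_fun M p" and p: "1 \<le> p"
  shows "(\<integral>x. norm (f x) \<partial>M) \<le> 2 * Lp_seminorm M p f"
proof -
  define I where "I = (\<integral>x. norm (f x) powr p \<partial>M)"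
  define c where "c = I powr (1 / p)"
  have I0: "0 \<le> I" by (simp add: I_def)
  have int: "integrable M (\<lambda>x. norm (f x) powr p)" by (rule Lp_fun_integrable_powr[OF f])
  show ?thesis
  \<comment> \<open>The pointwise bound needs \<open>c > 0\<close>; when \<open>I\<close> vanishes,
    \<open>f\<close> is zero almost everywhere.\<close>
  proof (cases "I = 0")
    case True
    then have "AE x in M. norm (f x) powr p = 0"
      using integral_nonneg_eq_0_iff_AE[OF int] by (simp add: I_def)
    then have "(\<integral>x. norm (f x) \<partial>M) = 0"
      by (intro integral_eq_zero_AE) auto
    then show ?thesis by (simp add: Lp_seminorm_def)
  next
    case False
    then have c: "0 < c" using I0 by (simp add: c_def)
    have "(\<integral>x. norm (f x) \<partial>M) \<le> (\<integral>x. c + c powr (1 - p) * norm (f x) powr p \<partial>M)"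
      using int Lp_fun_integrable_norm[OF f p] le_add_powr[OF norm_ge_zero c p]
      by (intro integral_mono) auto
    also have "\<dots> = c + c powr (1 - p) * I"
      using int by (simp add: I_def prob_space)
    \<comment> \<open>With this choice of \<open>c\<close> the second summand also equals
      \<open>c\<close>, whence the factor 2.\<close>
    also have "I = c powr p"
      using p I0 False by (simp add: c_def powr_powr)
    also have "c powr (1 - p) * c powr p = c"
      using c by (simp add: powr_add[symmetric])
    finally show ?thesis by (simp add: Lp_seminorm_def c_def I_def)
  qed
qed

section \<open>The weak topology separates points\<close>

text \<open>
  A strongly measurable function that does not vanish almost everywhere stays, on a set of positive
  measure, close to one of the countably many values of its simple approximations; a functional
  that norms this value is positive along the function there.
\<close>

lemma strongly_measurable_positive_functional:
  fixes h :: "'w \<Rightarrow> 'x::banach"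
  assumes h: "strongly_measurable M h" and nz: "\<not> (AE x in M. h x = 0)"
  obtains k :: "'x \<Rightarrow> real" and E where "linear k" "\<And>v. \<bar>k v\<bar> \<le> norm v" "E \<in> sets M"
    "emeasure M E \<noteq> 0" "\<And>x. x \<in> E \<Longrightarrow> 0 < k (h x)"
proof -
  obtain s where s: "\<And>i::nat. simple_function M (s i)" "\<And>x. x \<in> space M \<Longrightarrow> (\<lambda>i. s i x) \<longlonglongrightarrow> h x"
    using h by (rule strongly_measurableE) blast
  define V where "V = (\<Union>i. s i ` space M)"
  \<comment> \<open>The radius is half the norm of \<open>v\<close>, so that a functional norming
    \<open>v\<close> stays above \<open>norm v / 2\<close> on the ball; \<open>E 0\<close> is
    empty.\<close>
  define E where "E v = {x \<in> space M. norm (h x - v) < norm v / 2}" for v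
  have V: "countable V"
    unfolding V_def using simple_functionD(1)[OF s(1)] by (auto intro: countable_finite)
  have E: "E v \<in> sets M" for v
  proof -
    have "continuous_on UNIV (\<lambda>y. norm (y - v))" by (intro continuous_intros)
    from borel_measurable_continuous_strongly_measurable[OF h this]
    show ?thesis unfolding E_def by measurable
  qed
  \<comment> \<open>Otherwise countably many null sets would cover the set where \<open>h\<close> is
    nonzero.\<close>
  have "\<exists>v\<in>V. emeasure M (E v) \<noteq> 0"
  proof (rule ccontr)
    assume "\<not> ?thesis"
    then have "(\<Union>v\<in>V. E v) \<in> null_sets M"
      using V E by (intro null_sets_UN') (auto simp: null_sets_def)
    moreover have "{x \<in> space M. h x \<noteq> 0} \<subseteq> (\<Union>v\<in>V. E v)"
    proof safe
      fix x assume x: "x \<in> space M" and "h x \<noteq> 0"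
      \<comment> \<open>The limit is \<open>- norm (h x) / 2\<close>, so some approximation
        \<open>s i x\<close> is closer to \<open>h x\<close> than half its own norm, which puts
        \<open>x\<close> into \<open>E (s i x)\<close>.\<close>
      then have "(\<lambda>i. norm (h x - s i x) - norm (s i x) / 2) \<longlonglongrightarrow> norm (h x - h x) - norm (h x) / 2"
        by (intro tendsto_intros s(2)) auto
      moreover have "norm (h x - h x) - norm (h x) / 2 < 0" using \<open>h x \<noteq> 0\<close> by simp
      ultimately have "\<forall>\<^sub>F i in sequentially. norm (h x - s i x) - norm (s i x) / 2 < 0"
        by (rule order_tendstoD)
      then obtain i where "norm (h x - s i x) < norm (s i x) / 2"
        by (auto simp: eventually_sequentially)
      then show "x \<in> (\<Union>v\<in>V. E v)" using x by (auto simp: E_def V_def)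
    qed
    ultimately have "AE x in M. h x = 0" by (rule AE_I'[rotated, rotated])
    with nz show False by simp
  qed
  then obtain v where v: "emeasure M (E v) \<noteq> 0" by auto
  obtain k :: "'x \<Rightarrow> real" where k: "linear k" "\<And>x. \<bar>k x\<bar> \<le> norm x" "k v = norm v"
    using norming_functional[of v] by blast
  have "0 < k (h x)" if "x \<in> E v" for x
  proof -
    have "\<bar>k (h x) - norm v\<bar> < norm v / 2"
      using k(2)[of "h x - v"] that by (simp add: linear_diff[OF k(1)] k(3) E_def)
    then show ?thesis using norm_ge_zero[of v] by linarith
  qed
  with that k E v show ?thesis by blast
qed

section \<open>Integral functionals in the dual\<close>

lemma continuous_on_bounded_functional:
  fixes k :: "'x::real_normed_vector \<Rightarrow> real"
  assumes "linear k" "\<And>v. \<bar>k v\<bar> \<le> norm v"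
  shows "continuous_on UNIV k"
proof -
  have "bounded_linear k"
    using assms by (intro bounded_linear.intro bounded_linear_axioms.intro exI[of _ 1]) auto
  then show ?thesis by (simp add: linear_continuous_on)
qed

text \<open>The integrand is dominated by \<open>norm (f x)\<close>, so the comparison with the L^1
  norm gives both integrability and continuity, with constant 2.\<close>

lemma (in prob_space) Lp_dual_integral:
  fixes k :: "'x::banach \<Rightarrow> real"
  assumes k: "linear k" "\<And>v. \<bar>k v\<bar> \<le> norm v" and E: "E \<in> sets M" and p: "1 \<le> p"
  obtains l where "l \<in> Lp_dual M p"
    "\<And>f. f \<in> Lp_fun M p \<Longrightarrow> integrable M (\<lambda>x. indicator E x * k (f x))"
    "\<And>f. f \<in> Lp_fun M p \<Longrightarrow> l (Lp_class M p f) = (\<integral>x. indicator E x * k (f x) \<partial>M)"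
proof -
  define J where "J f = (\<integral>x. indicator E x * k (f x) \<partial>M)" for f :: "'a \<Rightarrow> 'x"
  \<comment> \<open>A functional must act on classes, so a representative is chosen;
    \<open>J\<close> agrees on all representatives because they coincide almost everywhere.\<close>
  define l where "l u = J (SOME f. f \<in> u)" for u
  have meas: "(\<lambda>x. indicator E x * k (f x)) \<in> borel_measurable M" if "f \<in> Lp_fun M p" for f :: "'a \<Rightarrow> 'x"
    using borel_measurable_continuous_strongly_measurable[OF Lp_fun_strongly_measurable[OF that]
        continuous_on_bounded_functional[OF k]] E by measurable
  have bd: "\<bar>indicator E x * k (f x)\<bar> \<le> norm (f x)" for f x
    using k(2)[of "f x"] by (auto simp: indicator_def)
  have int: "integrable M (\<lambda>x. indicator E x * k (f x))" if "f \<in> Lp_fun M p" for f :: "'a \<Rightarrow> 'x"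
    by (rule Bochner_Integration.integrable_bound[OF Lp_fun_integrable_norm[OF that p] meas[OF that]])
      (use bd in auto)
  have l: "l (Lp_class M p f) = J f" if f: "f \<in> Lp_fun M p" for f :: "'a \<Rightarrow> 'x"
  proof -
    define g where "g = (SOME f'. f' \<in> Lp_class M p f)"
    have "g \<in> Lp_class M p f"
      using Lp_class_self[OF f] unfolding g_def
      by (rule someI[where P = "\<lambda>f'. f' \<in> Lp_class M p f"])
    then have "g \<in> Lp_fun M p" "AE x in M. f x = g x" by (auto simp: mem_Lp_class)
    then have "J g = J f"
      unfolding J_def using meas f by (intro integral_cong_AE) auto
    then show ?thesis by (simp add: l_def g_def)
  qed
  have "l \<in> Lp_dual M p"
    unfolding Lp_dual_def
  proof (intro CollectI conjI ballI allI exI)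
    fix f g :: "'a \<Rightarrow> 'x" assume fg: "f \<in> Lp_fun M p" "g \<in> Lp_fun M p"
    then have "J (\<lambda>x. f x + g x) = J f + J g"
      unfolding J_def using int
      by (simp add: linear_add[OF k(1)] distrib_left Bochner_Integration.integral_add)
    then show "l (Lp_class M p (\<lambda>x. f x + g x)) = l (Lp_class M p f) + l (Lp_class M p g)"
      using fg p by (simp add: l Lp_fun_add)
  next
    fix c and f :: "'a \<Rightarrow> 'x" assume f: "f \<in> Lp_fun M p"
    have "J (\<lambda>x. c *\<^sub>R f x) = c * J f"
      unfolding J_def by (simp add: linear_cmul[OF k(1)] mult.left_commute)
    then show "l (Lp_class M p (\<lambda>x. c *\<^sub>R f x)) = c * l (Lp_class M p f)"
      using f by (simp add: l Lp_fun_scaleR)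
  next
    fix u :: "('a \<Rightarrow> 'x) set" assume "u \<in> Lp M p"
    then obtain f where f: "f \<in> Lp_fun M p" "u = Lp_class M p f" by (rule Lp_cases)
    have "\<bar>J f\<bar> \<le> (\<integral>x. \<bar>indicator E x * k (f x)\<bar> \<partial>M)"
      unfolding J_def by (rule integral_abs_bound)
    also have "\<dots> \<le> (\<integral>x. norm (f x) \<partial>M)"
      using int[OF f(1)] Lp_fun_integrable_norm[OF f(1) p] bd by (intro integral_mono) auto
    also have "\<dots> \<le> 2 * Lp_seminorm M p f" by (rule integral_norm_le_Lp_seminorm[OF f(1) p])
    finally show "\<bar>l u\<bar> \<le> 2 * Lp_norm M p u"
      using f by (simp add: l Lp_norm_class)
  qed
  with int l that show ?thesis by (auto simp: J_def)
qed

text \<open>The difference of two representatives is not zero almost everywhere, so some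
  \<open>k\<close> is positive along it on a set \<open>E\<close> of nonzero measure. Equal values
  of \<open>l\<close> would make the integral of this positive function over \<open>E\<close>
  vanish, and \<open>E\<close> would be null.\<close>

lemma Lp_dual_separates:
  fixes u v :: "('w \<Rightarrow> 'x::banach) set"
  assumes "prob_space M" and p: "1 \<le> p"
    and u: "u \<in> Lp M p" and v: "v \<in> Lp M p" and "u \<noteq> v"
  obtains l where "l \<in> Lp_dual M p" "l u \<noteq> l v"
proof -
  interpret prob_space M by fact
  obtain f g where f: "f \<in> Lp_fun M p" "u = Lp_class M p f"
    and g: "g \<in> Lp_fun M p" "v = Lp_class M p g"
    using u v by (metis Lp_cases)
  have "\<not> (AE x in M. f x = g x)"
    using \<open>u \<noteq> v\<close> f g Lp_class_eqI by metis
  then have nz: "\<not> (AE x in M. f x - g x = 0)" by simp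
  have "strongly_measurable M (\<lambda>x. f x - g x)"
    using f g by (intro strongly_measurable_diff Lp_fun_strongly_measurable)
  from this nz obtain k :: "'x \<Rightarrow> real" and E where k: "linear k" "\<And>y. \<bar>k y\<bar> \<le> norm y"
    and E: "E \<in> sets M" "emeasure M E \<noteq> 0" "\<And>x. x \<in> E \<Longrightarrow> 0 < k (f x - g x)"
    by (rule strongly_measurable_positive_functional) blast
  obtain l where l: "l \<in> Lp_dual M p"
    and int: "\<And>f. f \<in> Lp_fun M p \<Longrightarrow> integrable M (\<lambda>x. indicator E x * k (f x))"
    and eq: "\<And>f. f \<in> Lp_fun M p \<Longrightarrow> l (Lp_class M p f) = (\<integral>x. indicator E x * k (f x) \<partial>M)"
    by (rule Lp_dual_integral[OF k E(1) p]) blast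
  have "l u \<noteq> l v"
  proof
    assume "l u = l v"
    then have "(\<integral>x. indicator E x * k (f x) - indicator E x * k (g x) \<partial>M) = 0"
      using int f g eq by (simp add: Bochner_Integration.integral_diff)
    moreover have id: "indicator E x * k (f x) - indicator E x * k (g x)
        = indicator E x * k (f x - g x)" for x
      by (simp add: linear_diff[OF k(1)] right_diff_distrib)
    moreover have "integrable M (\<lambda>x. indicator E x * k (f x - g x))"
      unfolding id[symmetric] using int f g by auto
    ultimately have "AE x in M. indicator E x * k (f x - g x) = 0"
      using E(3) by (subst integral_nonneg_eq_0_iff_AE[symmetric])
        (auto simp: indicator_def less_imp_le)
    then have "AE x in M. x \<notin> E"
    proof eventually_elim
      case (elim x)
      then show ?case using E(3)[of x] by (cases "x \<in> E") auto
    qed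
    then have "emeasure M E = 0"
      using E(1) sets.sets_into_space[OF E(1)] by (subst (asm) AE_iff_measurable[OF E(1)]) auto
    with E(2) show False by simp
  qed
  with l that show ?thesis by blast
qed

text \<open>Points are weakly closed: by separation, the union \<open>N\<close> of the open
  conditions \<open>l v \<noteq> l u\<close> is the whole space without \<open>u\<close>.\<close>

lemma weak_nhd_avoiding_point:
  assumes "prob_space M" "1 \<le> p" "u \<in> Lp M p" "K \<subseteq> Lp M p" "u \<notin> K"
  obtains N where "weak_nhd M p K N" "u \<notin> N"
proof -
  define N where "N = (\<Union>l\<in>Lp_dual M p. {v \<in> Lp M p. l v \<in> - {l u}})"
  have "openin (weak_topology M p) {v \<in> Lp M p. l v \<in> - {l u}}" if "l \<in> Lp_dual M p" for l
    unfolding weak_topology_def using that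
    by (intro topology_generated_by_Basis) (auto intro!: exI[of _ l] exI[of _ "- {l u}"])
  then have "openin (weak_topology M p) N"
    unfolding N_def by blast
  moreover have "K \<subseteq> N"
  proof
    fix v assume "v \<in> K"
    then obtain l where "l \<in> Lp_dual M p" "l v \<noteq> l u"
      using Lp_dual_separates[of M p v u] assms by blast
    then show "v \<in> N" using \<open>v \<in> K\<close> assms(4) by (auto simp: N_def)
  qed
  moreover have "N \<subseteq> Lp M p" "u \<notin> N" by (auto simp: N_def)
  ultimately show ?thesis using that by (auto simp: weak_nhd_def)
qed

section \<open>Complete trajectories and the attractor\<close>

lemma complete_trajectory_in_attracting:
  assumes "prob_space M" "1 \<le> p" "\<D> \<subseteq> Lp_families M p"
    and K: "pullback_weakly_attracting M p \<D> \<Phi> K"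
    and \<phi>: "complete_trajectory M p \<Phi> \<phi>" "singleton_family \<phi> \<in> \<D>"
  shows "\<phi> t \<in> K t"
proof (rule ccontr)
  assume "\<phi> t \<notin> K t"
  moreover have "K t \<subseteq> Lp M p" "\<phi> t \<in> Lp M p"
    using assms by (auto simp: pullback_weakly_attracting_def Lp_families_def Lp_bounded_def
        complete_trajectory_def)
  ultimately obtain N where N: "weak_nhd M p (K t) N" "\<phi> t \<notin> N"
    using weak_nhd_avoiding_point[OF assms(1,2)] by blast
  have "\<forall>\<tau>. \<forall>D\<in>\<D>. \<forall>N. weak_nhd M p (K \<tau>) N \<longrightarrow>
      (\<exists>T>0. \<forall>t\<ge>T. \<Phi> t (\<tau> - t) ` D (\<tau> - t) \<subseteq> N)"
    using K by (simp add: pullback_weakly_attracting_def)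
  from this[THEN spec[of _ t], THEN bspec, OF \<phi>(2), THEN spec[of _ N], THEN mp, OF N(1)]
  obtain T where T: "T > 0" "\<Phi> T (t - T) ` singleton_family \<phi> (t - T) \<subseteq> N"
    by auto
  \<comment> \<open>The trajectory started at \<open>t - T\<close> returns to the same point
    \<open>\<phi> t\<close> for every \<open>T\<close>. Positivity of \<open>T\<close> matters,
    since the trajectory equation is stated for \<open>s < t\<close> only.\<close>
  have "\<phi> t = \<Phi> T (t - T) (\<phi> (t - T))"
  proof -
    have "t - T < t" using T(1) by simp
    then have "\<phi> t = \<Phi> (t - (t - T)) (t - T) (\<phi> (t - T))"
      using \<phi>(1) unfolding complete_trajectory_def by blast
    then show ?thesis by simp
  qed
  then show False using N(2) T(2) by (simp add: singleton_family_def)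
qed

text \<open>Preimages are chosen only at integer steps back from \<open>t\<close>; the flow fixes
  all times in between. The forward orbits from these points extend one another by the cocycle
  property and glue to one trajectory, which invariance keeps in \<open>A\<close>.\<close>

lemma invariant_family_complete_trajectory:
  assumes \<Phi>: "mean_rds M p \<Phi>" and inv: "invariant_family \<Phi> A"
    and Lp: "\<And>s. A s \<subseteq> Lp M p" and a: "a \<in> A t"
  obtains \<phi> where "complete_trajectory M p \<Phi> \<phi>" "\<And>s. \<phi> s \<in> A s" "\<phi> t = a"
proof -
  have coc: "\<Phi> (r + s) \<tau> u = \<Phi> r (s + \<tau>) (\<Phi> s \<tau> u)" if "r \<ge> 0" "s \<ge> 0" "u \<in> Lp M p" for r s \<tau> u
    using \<Phi> that by (auto simp: mean_rds_def)
  have fwd: "\<Phi> r s u \<in> A (s + r)" if "r \<ge> 0" "u \<in> A s" for r s u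
  proof -
    have "A (s + r) = \<Phi> r (s + r - r) ` A (s + r - r)"
      using inv that(1) unfolding invariant_family_def by blast
    then show ?thesis using that by simp
  qed
  have bwd: "\<exists>v. v \<in> A (s - 1) \<and> \<Phi> 1 (s - 1) v = u" if "u \<in> A s" for s u
  proof -
    have "A s = \<Phi> 1 (s - 1) ` A (s - 1)"
      using inv by (simp add: invariant_family_def)
    then show ?thesis using that by auto
  qed
  \<comment> \<open>The clause for \<open>n = 0\<close> pins the first point of the dependent choice
    to \<open>a\<close>.\<close>
  have "\<exists>x. \<forall>n. (x n \<in> A (t - real n) \<and> (n = 0 \<longrightarrow> x n = a)) \<and>
      \<Phi> 1 (t - real (Suc n)) (x (Suc n)) = x n"
  proof (rule dependent_nat_choice)
    show "\<exists>x. x \<in> A (t - real 0) \<and> (0 = (0::nat) \<longrightarrow> x = a)" using a by simp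
    fix x and n :: nat assume "x \<in> A (t - real n) \<and> (n = 0 \<longrightarrow> x = a)"
    then show "\<exists>y. (y \<in> A (t - real (Suc n)) \<and> (Suc n = 0 \<longrightarrow> y = a)) \<and>
        \<Phi> 1 (t - real (Suc n)) y = x"
      using bwd[of x "t - real n"] by (auto simp: algebra_simps)
  qed
  then obtain x where xA: "\<And>n. x n \<in> A (t - real n)" and x0: "x 0 = a"
    and xS: "\<And>n. \<Phi> 1 (t - real (Suc n)) (x (Suc n)) = x n" by blast
  have xLp: "x n \<in> Lp M p" for n using xA Lp by blast
  \<comment> \<open>The orbit started at time \<open>t - real n\<close>; it is meaningful only from
    that time on.\<close>
  define \<psi> where "\<psi> n s = \<Phi> (s - (t - real n)) (t - real n) (x n)" for n s
  \<comment> \<open>The orbit that starts one unit earlier passes through \<open>x n\<close> after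
    time 1 and then coincides with the later one.\<close>
  have step: "\<psi> (Suc n) s = \<psi> n s" if "t - real n \<le> s" for n s
  proof -
    have "\<psi> (Suc n) s = \<Phi> ((s - (t - real n)) + 1) (t - real (Suc n)) (x (Suc n))"
      by (simp add: \<psi>_def algebra_simps)
    also have "\<dots> = \<Phi> (s - (t - real n)) (1 + (t - real (Suc n))) (x n)"
      using that unfolding xS[of n, symmetric] by (intro coc xLp) auto
    finally show ?thesis by (simp add: \<psi>_def)
  qed
  have stable: "\<psi> n s = \<psi> m s" if "t - real m \<le> s" "m \<le> n" for m n s
    using that(2)
  proof (induction n rule: dec_induct)
    case (step n)
    then show ?case using that(1) \<open>\<And>s n. t - real n \<le> s \<Longrightarrow> \<psi> (Suc n) s = \<psi> n s\<close>[of n s] by simp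
  qed simp
  \<comment> \<open>The index is the least \<open>n\<close> with \<open>t - real n \<le> s\<close>;
    \<open>nat\<close> makes it 0 for \<open>s \<ge> t\<close>. By \<open>stable\<close>, any larger
    index gives the same value.\<close>
  define \<phi> where "\<phi> s = \<psi> (nat \<lceil>t - s\<rceil>) s" for s
  have ceil: "t - real (nat \<lceil>t - s\<rceil>) \<le> s" for s by linarith
  have \<phi>: "\<phi> s = \<psi> n s" if "t - real n \<le> s" for n s
  proof -
    have "nat \<lceil>t - s\<rceil> \<le> n" using that by (simp add: nat_le_iff ceiling_le_iff)
    from stable[OF ceil this] show ?thesis by (simp add: \<phi>_def)
  qed
  have \<phi>A: "\<phi> s \<in> A s" for s
    using fwd[OF _ xA, of "s - (t - real (nat \<lceil>t - s\<rceil>))" "nat \<lceil>t - s\<rceil>"] ceil[of s]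
    by (simp add: \<phi>_def \<psi>_def)
  have "complete_trajectory M p \<Phi> \<phi>"
    unfolding complete_trajectory_def
  proof (intro conjI allI impI)
    show "\<phi> s \<in> Lp M p" for s using \<phi>A Lp by blast
    fix r s :: real assume "r < s"
    \<comment> \<open>An index admissible for the earlier time \<open>r\<close> also serves
      \<open>s\<close>, so both values lie on one orbit and the cocycle property applies.\<close>
    define n where "n = nat \<lceil>t - r\<rceil>"
    have n: "t - real n \<le> r" using ceil by (simp add: n_def)
    have "\<phi> s = \<Phi> (s - (t - real n)) (t - real n) (x n)"
      using \<phi>[of n s] n \<open>r < s\<close> by (simp add: \<psi>_def)
    also have "s - (t - real n) = (s - r) + (r - (t - real n))"
      by simp
    also have "\<Phi> ((s - r) + (r - (t - real n))) (t - real n) (x n) = \<Phi> (s - r) r (\<psi> n r)"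
      using coc[OF _ _ xLp, of "s - r" "r - (t - real n)"] n \<open>r < s\<close> by (simp add: \<psi>_def)
    finally show "\<phi> s = \<Phi> (s - r) r (\<phi> r)" using \<phi>[OF n] by simp
  qed
  moreover have "\<phi> t = a"
    using \<Phi> xLp[of 0] \<phi>[of 0 t] by (simp add: \<psi>_def x0 mean_rds_def)
  ultimately show ?thesis using that \<phi>A by blast
qed

text \<open>The conjuncts differ in how trajectories get into \<open>\<D>\<close>. Attraction puts
  those of \<open>\<D>\<close> into \<open>A\<close>. Conversely, a trajectory built inside
  \<open>A\<close> need not belong to \<open>\<D>\<close> merely because \<open>A\<close> does; the
  first equality is therefore stated for inclusion-closed \<open>\<D>\<close>, and the second uses
  that \<open>\<D>\<close> contains all bounded families.\<close>

theorem lemma8: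
  fixes M :: "'w measure" and p :: real
    and \<D> :: "('w, 'x::banach) Lp_family set"
    and \<Phi> :: "('w, 'x) Lp_flow"
    and A :: "('w, 'x) Lp_family"
  assumes "prob_space M" and "1 < p"
    and "\<D> \<subseteq> Lp_families M p"
    and "mean_rds M p \<Phi>"
    and "weak_pullback_attractor M p \<D> \<Phi> A"
    and "invariant_family \<Phi> A"
    and "bounded_family M p A"
  shows "(\<forall>t. {\<phi> t | \<phi>. bounded_complete_trajectory M p \<Phi> \<phi> \<and> singleton_family \<phi> \<in> \<D>} \<subseteq> A t) \<and>
    (inclusion_closed \<D> \<longrightarrow>
      (\<forall>t. A t = {\<phi> t | \<phi>. bounded_complete_trajectory M p \<Phi> \<phi> \<and> singleton_family \<phi> \<in> \<D>})) \<and>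
    ((\<forall>D\<in>Lp_families M p. bounded_family M p D \<longrightarrow> D \<in> \<D>) \<longrightarrow>
      (\<forall>t. A t = {\<phi> t | \<phi>. bounded_complete_trajectory M p \<Phi> \<phi>}))"
proof -
  have A\<D>: "A \<in> \<D>" and attr: "pullback_weakly_attracting M p \<D> \<Phi> A"
    using assms(5) by (auto simp: weak_pullback_attractor_def)
  have ALp: "A s \<subseteq> Lp M p" for s
    using A\<D> assms(3) by (auto simp: Lp_families_def Lp_bounded_def)
  have sub: "\<phi> t \<in> A t" if "bounded_complete_trajectory M p \<Phi> \<phi>" "singleton_family \<phi> \<in> \<D>" for \<phi> t
    using complete_trajectory_in_attracting[OF assms(1) _ assms(3) attr] that assms(2)
    by (auto simp: bounded_complete_trajectory_def)
  \<comment> \<open>Boundedness of the trajectory is inherited from the uniform bound on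
    \<open>A\<close>.\<close>
  have ex: "\<exists>\<phi>. bounded_complete_trajectory M p \<Phi> \<phi> \<and> (\<forall>s. \<phi> s \<in> A s) \<and> \<phi> t = a"
    if a: "a \<in> A t" for a t
  proof -
    obtain \<phi> where \<phi>: "complete_trajectory M p \<Phi> \<phi>" "\<And>s. \<phi> s \<in> A s" "\<phi> t = a"
      using invariant_family_complete_trajectory[OF assms(4,6) ALp a] by blast
    have "bounded_family M p (singleton_family \<phi>)"
      using assms(7) \<phi>(2) unfolding bounded_family_def Lp_bounded_def singleton_family_def by blast
    with \<phi> show ?thesis by (auto simp: bounded_complete_trajectory_def)
  qed
  have closed: "singleton_family \<phi> \<in> \<D>" if "inclusion_closed \<D>" "\<forall>s. \<phi> s \<in> A s" for \<phi>
  proof -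
    have "\<forall>s. singleton_family \<phi> s \<noteq> {} \<and> singleton_family \<phi> s \<subseteq> A s"
      using that(2) by (simp add: singleton_family_def)
    then show ?thesis
      using that(1) A\<D> unfolding inclusion_closed_def by blast
  qed
  \<comment> \<open>This makes \<open>sub\<close> applicable to every bounded complete
    trajectory.\<close>
  have all: "singleton_family \<phi> \<in> \<D>"
    if "\<forall>D\<in>Lp_families M p. bounded_family M p D \<longrightarrow> D \<in> \<D>" "bounded_complete_trajectory M p \<Phi> \<phi>" for \<phi>
  proof -
    have b: "bounded_family M p (singleton_family \<phi>)"
      using that(2) by (simp add: bounded_complete_trajectory_def)
    then have "singleton_family \<phi> \<in> Lp_families M p"
      by (auto simp: bounded_family_def Lp_bounded_def Lp_families_def singleton_family_def)
    with b that(1) show ?thesis by blast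
  qed
  show ?thesis
  proof (intro conjI impI allI)
    fix t
    show "{\<phi> t | \<phi>. bounded_complete_trajectory M p \<Phi> \<phi> \<and> singleton_family \<phi> \<in> \<D>} \<subseteq> A t"
      using sub by blast
    show "A t = {\<phi> t | \<phi>. bounded_complete_trajectory M p \<Phi> \<phi> \<and> singleton_family \<phi> \<in> \<D>}"
      if "inclusion_closed \<D>"
    proof (intro equalityI subsetI)
      fix a assume "a \<in> A t"
      from ex[OF this] closed[OF that]
      show "a \<in> {\<phi> t | \<phi>. bounded_complete_trajectory M p \<Phi> \<phi> \<and> singleton_family \<phi> \<in> \<D>}"
        by auto
    qed (use sub in auto)
    show "A t = {\<phi> t | \<phi>. bounded_complete_trajectory M p \<Phi> \<phi>}"
      if "\<forall>D\<in>Lp_families M p. bounded_family M p D \<longrightarrow> D \<in> \<D>"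
    proof (intro equalityI subsetI)
      fix a assume "a \<in> A t"
      from ex[OF this] show "a \<in> {\<phi> t | \<phi>. bounded_complete_trajectory M p \<Phi> \<phi>}"
        by auto
    qed (use sub all[OF that] in auto)
  qed
qed

end
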